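(* Let $X$ be a real Banach space, let $K\subset X$ be a normal cone with normal constant $c>0$, let $D\subset X$ be an open bounded set with $0\in D$ and let $y\in X$ be fixed. Assume that $T:\overline{D}_{K_y}\to K$ is a mapping (not necessarily continuous) such that $T\,\overline{D}_{K_y}$ is relatively compact and \[\inf\{\|v\|: v\in\mathbb{T}x,\ x\in\partial D_{K_y}\}>0,\] where $\mathbb{T}$ is the closed-convex envelope of $T$. If there exists a number \[\bar\lambda>\frac{c\,\sup_{x\in\partial D}\|x\|}{\inf\{\|v\|: v\in\mathbb{T}x,\ x\in\partial D_{K_y}\}}\] such that for each $\lambda\in(0,\bar\lambda]$ the operator $T_{(y,\lambda)}:=y+\lambda T$ satisfies \[\{x\}\cap \mathbb{T}_{(y,\lambda)}(x)\subset\{T_{(y,\lambda)}(x)\}\quad\text{for every } x\in\overline{D}_{K_y}\] (with $\mathbb{T}_{(y,\lambda)}$ the closed-convex envelope of $T_{(y,\lambda)}$), then there exist $x^*\in\partial D_{K_y}$ and $\lambda^*\in(0,\bar\lambda)$ such that $x^*=y+\lambda^*\,T(x^* )$.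
   Context: A cone is a closed convex set $K\subset X$ with $\mu x\in K$ for all $x\in K,\mu\ge0$, and $K\cap(-K)=\{0\}$; it induces the order $u\preceq v\iff v-u\in K$. $K$ is normal with constant $c>0$ if $\|u\|\le c\|v\|$ whenever $0\preceq u\preceq v$. For $y\in X$, $K_y:=y+K$; $D_{K_y}:=(y+D)\cap K_y$, and $\overline{D}_{K_y}$, $\partial D_{K_y}$ denote its closure and boundary relative to $K_y$; $\partial D$ is the boundary of $D$ in $X$. For a closed convex $C$, relatively open $U\subset C$ and a map $S:\overline U\to C$, the closed-convex envelope is $\mathbb{S}:\overline U\to 2^X$, $\mathbb{S}x=\bigcap_{\varepsilon>0}\overline{\mathrm{co}}\,S(\overline B_\varepsilon(x)\cap\overline U)$ ($\overline B_\varepsilon(x)$ closed ball, $\overline{\mathrm{co}}$ closed convex hull).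
   Formalization: The cone K is assumed to be different from {0}; for K = {0} the relative boundary of D_{K_y} is empty, so the infimum is over the empty set and the conclusion fails although the other hypotheses hold. *)

theory Defs
  imports "HOL-Analysis.Analysis"
begin

definition is_cone :: "'a::real_normed_vector set \<Rightarrow> bool" where
  "is_cone K \<longleftrightarrow> closed K \<and> convex K \<and> (\<forall>x\<in>K. \<forall>\<mu>::real. \<mu> \<ge> 0 \<longrightarrow> \<mu> *\<^sub>R x \<in> K)
                 \<and> K \<inter> uminus ` K = {0}"

definition cone_le :: "'a::real_normed_vector set \<Rightarrow> 'a \<Rightarrow> 'a \<Rightarrow> bool" where
  "cone_le K u v \<longleftrightarrow> v - u \<in> K"

definition normal_cone :: "'a::real_normed_vector set \<Rightarrow> real \<Rightarrow> bool" where
  "normal_cone K c \<longleftrightarrow> is_cone K \<and> c > 0 \<and>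
     (\<forall>u v. cone_le K 0 u \<and> cone_le K u v \<longrightarrow> norm u \<le> c * norm v)"

definition shifted_cone :: "'a::real_normed_vector \<Rightarrow> 'a set \<Rightarrow> 'a set" where
  "shifted_cone y K = (\<lambda>k. y + k) ` K"

definition DK :: "'a::real_normed_vector set \<Rightarrow> 'a set \<Rightarrow> 'a \<Rightarrow> 'a set" where
  "DK D K y = ((\<lambda>d. y + d) ` D) \<inter> shifted_cone y K"

definition DK_closure :: "'a::real_normed_vector set \<Rightarrow> 'a set \<Rightarrow> 'a \<Rightarrow> 'a set" where
  "DK_closure D K y = (top_of_set (shifted_cone y K)) closure_of (DK D K y)"

definition DK_boundary :: "'a::real_normed_vector set \<Rightarrow> 'a set \<Rightarrow> 'a \<Rightarrow> 'a set" where
  "DK_boundary D K y = (top_of_set (shifted_cone y K)) frontier_of (DK D K y)"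

definition cc_envelope :: "'a::real_normed_vector set \<Rightarrow> ('a \<Rightarrow> 'a) \<Rightarrow> 'a \<Rightarrow> 'a set" where
  "cc_envelope Ubar S x = (\<Inter>\<epsilon>\<in>{0<..}. closure (convex hull (S ` (cball x \<epsilon> \<inter> Ubar))))"

end

theory Submission
  imports Defs
begin

text \<open>
  Since the norm of \<open>\<bbbT>x\<close> is at least \<open>m > 0\<close> on the boundary and \<open>c \<ge> 1\<close>, every solution of
  \<open>x \<in> y + \<lambda> \<bbbT>x\<close> on the boundary has \<open>\<lambda> \<le> c sup \<parallel>\<partial>D\<parallel> / m\<close>, so it suffices to find a
  solution with some \<open>\<lambda> > 0\<close>. The closed-convex envelope of an arbitrary self-map \<open>h\<close> of a compact
  convex set has a fixed point (approximate \<open>h\<close> by partitions of unity, then use Kuhn's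
  combinatorial lemma). Near the boundary \<open>T\<close> stays above \<open>m/2\<close> in norm, so the values of \<open>T\<close>
  below \<open>m/2\<close> can be replaced by a fixed \<open>a \<in> K\<close> of norm \<open>m\<close>; normality of \<open>K\<close> and compactness then
  keep the convex hull of the range of the new map \<open>T'\<close> away from \<open>0\<close>. Take \<open>h = y + L T'\<close> on the
  closed domain and \<open>h = y\<close> outside it, with \<open>L\<close> so large that \<open>y + L v\<close> leaves the domain for all
  \<open>v\<close> in that hull. A fixed point \<open>x\<close> of the envelope of \<open>h\<close> cannot lie outside the closed domain (it
  would equal \<open>y\<close>) nor inside the relatively open one (it would be \<open>y + L v\<close>). Hence \<open>x\<close> is a
  boundary point, and the jump of \<open>h\<close> there puts \<open>x\<close> on the segment from \<open>y\<close> to \<open>y + L v\<close> for some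
  \<open>v \<in> \<bbbT>x\<close>.
\<close>

section \<open>Approximate fixed points by Kuhn's labelling\<close>

text \<open>Grid vertices are labelled by the direction in which \<open>F\<close> moves coordinate
  \<open>i\<close>. Kuhn's lemma yields a cell carrying both labels for every \<open>i\<close>, so
  \<open>F t i - t i\<close> changes sign on it and, by uniform continuity, is small at its lower
  corner. Points are functions read below \<open>n\<close> only, which keeps the dimension a free
  number.\<close>

lemma cube_approximate_fixpoint:
  fixes F :: "(nat \<Rightarrow> real) \<Rightarrow> nat \<Rightarrow> real"
  assumes range: "\<And>t i. \<lbrakk>\<forall>j<n. t j \<in> {0..1}; i < n\<rbrakk> \<Longrightarrow> F t i \<in> {0..1}"
    and ucont: "\<And>e. e > 0 \<Longrightarrow> \<exists>d>0. \<forall>t s. (\<forall>j<n. t j \<in> {0..1} \<and> s j \<in> {0..1} \<and> \<bar>t j - s j\<bar> \<le> d)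
                   \<longrightarrow> (\<forall>i<n. \<bar>F t i - F s i\<bar> \<le> e)"
    and e: "e > 0"
  shows "\<exists>t. (\<forall>j<n. t j \<in> {0..1}) \<and> (\<forall>i<n. \<bar>F t i - t i\<bar> \<le> e)"
proof -
  obtain d where d: "d > 0" and F_d: "\<And>t s i. \<lbrakk>\<forall>j<n. t j \<in> {0..1} \<and> s j \<in> {0..1} \<and> \<bar>t j - s j\<bar> \<le> d; i < n\<rbrakk>
      \<Longrightarrow> \<bar>F t i - F s i\<bar> \<le> e/2"
    using ucont[of "e/2"] e by (metis half_gt_zero)
  obtain p :: nat where p: "p > 0" "1 / real p < min d (e/2)"
    using d e by (metis half_gt_zero min_less_iff_conj nat_approx_posE zero_less_Suc)
  define pt where "pt x = (\<lambda>j. real (x j) / real p)" for x :: "nat \<Rightarrow> nat"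
  have pt_cube: "pt x j \<in> {0..1}" if "x j \<le> p" for x j
    using that p by (simp add: pt_def)
  \<comment> \<open>The clause \<open>x i \<noteq> p\<close> forces label 1 on the upper face, as
    Kuhn's lemma demands; it is harmless because \<open>F\<close> is at most 1 there.\<close>
  define label :: "(nat \<Rightarrow> nat) \<Rightarrow> nat \<Rightarrow> nat"
    where "label x i = (if F (pt x) i \<ge> pt x i \<and> x i \<noteq> p then 0 else 1)" for x i
  have label0: "\<forall>x. (\<forall>i<n. x i \<le> p) \<longrightarrow> (\<forall>i<n. x i = 0 \<longrightarrow> label x i = 0)"
  proof (intro allI impI)
    fix x i assume *: "\<forall>i<n. x i \<le> p" "i < n" "x i = 0"
    have "F (pt x) i \<in> {0..1}" using * by (intro range) (auto intro!: pt_cube simp del: atLeastAtMost_iff)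
    then show "label x i = 0" using * p by (simp add: label_def pt_def)
  qed
  obtain q where q: "\<forall>i<n. q i < p"
    and rs: "\<forall>i<n. \<exists>r s. (\<forall>j<n. q j \<le> r j \<and> r j \<le> q j + 1) \<and> (\<forall>j<n. q j \<le> s j \<and> s j \<le> q j + 1)
                \<and> label r i \<noteq> label s i"
    by (rule kuhn_lemma[OF p(1) _ label0]) (auto simp: label_def)
  \<comment> \<open>Half of \<open>e\<close> pays for the oscillation of \<open>F\<close> over the
    cell, the other half for the mesh.\<close>
  have near: "\<bar>F (pt q) i - F (pt r) i\<bar> \<le> e/2 \<and> pt q i \<le> pt r i \<and> pt r i \<le> pt q i + e/2"
    if r: "\<forall>j<n. q j \<le> r j \<and> r j \<le> q j + 1" and i: "i < n" for r i
  proof -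
    have *: "pt q j \<le> pt r j \<and> pt r j \<le> pt q j + 1 / p" if "j < n" for j
    proof -
      have "real (q j) \<le> real (r j)" "real (r j) \<le> real (q j) + 1" using r that by force+
      then show ?thesis using p by (simp add: pt_def field_simps)
    qed
    have "pt q j \<in> {0..1} \<and> pt r j \<in> {0..1} \<and> \<bar>pt q j - pt r j\<bar> \<le> d" if "j < n" for j
    proof -
      have "r j \<le> p" "q j \<le> p" using r q that by force+
      then show ?thesis using *[OF that] p pt_cube by force
    qed
    then show ?thesis using F_d i *[OF i] p(2) by fastforce
  qed
  have "\<bar>F (pt q) i - pt q i\<bar> \<le> e" if i: "i < n" for i
  proof -
    obtain r s where r: "\<forall>j<n. q j \<le> r j \<and> r j \<le> q j + 1" and s: "\<forall>j<n. q j \<le> s j \<and> s j \<le> q j + 1"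
      and "label r i = 0" "label s i \<noteq> 0"
    proof -
      obtain a b where ab: "\<forall>j<n. q j \<le> a j \<and> a j \<le> q j + 1" "\<forall>j<n. q j \<le> b j \<and> b j \<le> q j + 1"
        "label a i \<noteq> label b i" using rs i by blast
      show ?thesis
      proof (cases "label a i = 0")
        case True then show ?thesis using ab that by metis
      next
        case False
        then have "label b i = 0" using ab(3) by (auto simp: label_def split: if_splits)
        then show ?thesis using ab that False by metis
      qed
    qed
    have "F (pt s) i \<le> pt s i"
    proof (cases "s i = p")
      case True
      have "\<forall>j<n. s j \<le> p" using s q by force
      then have "F (pt s) i \<in> {0..1}" using i by (intro range) (auto intro!: pt_cube simp del: atLeastAtMost_iff)
      then show ?thesis using True p by (simp add: pt_def)
    next
      case False
      then show ?thesis using \<open>label s i \<noteq> 0\<close> by (auto simp: label_def split: if_splits)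
    qed
    moreover have "F (pt r) i \<ge> pt r i"
      using \<open>label r i = 0\<close> by (auto simp: label_def split: if_splits)
    ultimately show ?thesis using near[OF r i] near[OF s i] by linarith
  qed
  moreover have "\<forall>j<n. pt q j \<in> {0..1}" using q pt_cube by (meson less_imp_le)
  ultimately show ?thesis by blast
qed

text \<open>The problem is moved to the cube of weights: \<open>t\<close> determines a point
  \<open>x t\<close> of \<open>Q\<close>, whose weights \<open>\<phi> i (x t)\<close> lie in the
  cube again. Nearly fixed weights give a nearly fixed point.\<close>

lemma convex_approximate_fixpoint:
  fixes Q :: "'a::real_normed_vector set" and w :: "nat \<Rightarrow> 'a" and \<phi> :: "nat \<Rightarrow> 'a \<Rightarrow> real"
  assumes Q: "compact Q" "convex Q" and w: "\<And>i. i < n \<Longrightarrow> w i \<in> Q"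
    and cont: "\<And>i. i < n \<Longrightarrow> continuous_on Q (\<phi> i)"
    and nonneg: "\<And>i x. \<lbrakk>i < n; x \<in> Q\<rbrakk> \<Longrightarrow> \<phi> i x \<ge> 0"
    and sum1: "\<And>x. x \<in> Q \<Longrightarrow> (\<Sum>i<n. \<phi> i x) = 1"
    and e: "e > 0" and ne: "Q \<noteq> {}"
  shows "\<exists>x\<in>Q. norm (x - (\<Sum>i<n. \<phi> i x *\<^sub>R w i)) \<le> e"
proof -
  obtain w0 where w0: "w0 \<in> Q" using ne by blast
  \<comment> \<open>Dividing by \<open>N\<close> brings the total weight to at most 1 and
    \<open>w0\<close> takes the remainder, so the whole cube lands in \<open>Q\<close>. The
    \<open>max\<close> keeps the divisor away from 0 and makes it 1 for weights of sum 1.\<close>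
  define N where "N t = max 1 (\<Sum>i<n. t i)" for t :: "nat \<Rightarrow> real"
  define x where "x t = w0 + (\<Sum>i<n. (t i / N t) *\<^sub>R (w i - w0))" for t
  define M where "M = 1 + (\<Sum>i<n. norm (w i - w0))"
  have M: "M > 0" by (auto simp: M_def intro!: add_pos_nonneg sum_nonneg)
  have N1: "N t \<ge> 1" for t by (simp add: N_def)
  have lin: "norm (\<Sum>i<n. a i *\<^sub>R (w i - w0)) \<le> b * M" if "\<And>i. i < n \<Longrightarrow> \<bar>a i\<bar> \<le> b" "b \<ge> 0" for a b
  proof -
    have "norm (\<Sum>i<n. a i *\<^sub>R (w i - w0)) \<le> (\<Sum>i<n. b * norm (w i - w0))"
      by (rule sum_norm_le) (use that in \<open>auto intro!: mult_right_mono\<close>)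
    also have "\<dots> \<le> b * M" using that by (simp add: M_def sum_distrib_left[symmetric] distrib_left)
    finally show ?thesis .
  qed
  have xQ: "x t \<in> Q" if t: "\<forall>j<n. t j \<in> {0..1}" for t
  proof -
    define c where "c i = (if i < n then t i / N t else 1 - (\<Sum>i<n. t i / N t))" for i
    have "(\<Sum>i<n. t i / N t) \<le> 1"
      using N1[of t] by (simp add: sum_divide_distrib[symmetric]) (simp add: N_def)
    then have c0: "c i \<ge> 0" for i using t N1[of t] by (auto simp: c_def)
    have "x t = (\<Sum>i<Suc n. c i *\<^sub>R (if i < n then w i else w0))"
      by (simp add: x_def c_def algebra_simps sum_subtractf scaleR_sum_left)
    moreover have "\<dots> \<in> Q"
      by (rule convex_sum) (use Q w w0 c0 in \<open>auto simp: c_def\<close>)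
    ultimately show ?thesis by simp
  qed
  \<comment> \<open>Normalised weights are Lipschitz: the numerator contributes 1, the change of
    \<open>N\<close> contributes \<open>n\<close>.\<close>
  have coeff: "\<bar>t i / N t - s i / N s\<bar> \<le> (real n + 1) * d"
    if ts: "\<forall>j<n. t j \<in> {0..1} \<and> s j \<in> {0..1} \<and> \<bar>t j - s j\<bar> \<le> d" and i: "i < n" for t s d i
  proof -
    have "\<bar>(\<Sum>i<n. t i) - (\<Sum>i<n. s i)\<bar> \<le> (\<Sum>i<n. \<bar>t i - s i\<bar>)"
      by (simp add: sum_subtractf[symmetric])
    also have "\<dots> \<le> n * d" using sum_bounded_above[of "{..<n}" "\<lambda>i. \<bar>t i - s i\<bar>" d] ts by simp
    finally have NN: "\<bar>N s - N t\<bar> \<le> n * d" by (auto simp: N_def)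
    have "t i / N t - s i / N s = (t i - s i) / N t + s i / N s * ((N s - N t) / N t)"
      using N1[of s] N1[of t] by (simp add: field_simps)
    also have "\<bar>\<dots>\<bar> \<le> \<bar>(t i - s i) / N t\<bar> + \<bar>s i / N s\<bar> * \<bar>(N s - N t) / N t\<bar>"
      by (metis abs_mult abs_triangle_ineq)
    also have "\<dots> \<le> d + 1 * (n * d)"
    proof (intro add_mono mult_mono)
      have A: "\<bar>u / N t\<bar> \<le> v" if "\<bar>u\<bar> \<le> v" for u v
        using that N1[of t] mult_mono[of "\<bar>u\<bar>" v 1 "N t"] by (simp add: divide_le_eq)
      show "\<bar>(t i - s i) / N t\<bar> \<le> d" "\<bar>(N s - N t) / N t\<bar> \<le> n * d" using A ts i NN by auto
      have "s i \<in> {0..1}" using ts i by blast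
      then show "\<bar>s i / N s\<bar> \<le> 1" using N1[of s] by simp
    qed auto
    finally show ?thesis by (simp add: algebra_simps)
  qed
  have "\<exists>d>0. \<forall>t s. (\<forall>j<n. t j \<in> {0..1} \<and> s j \<in> {0..1} \<and> \<bar>t j - s j\<bar> \<le> d)
                   \<longrightarrow> (\<forall>i<n. \<bar>\<phi> i (x t) - \<phi> i (x s)\<bar> \<le> \<epsilon>)" if "\<epsilon> > 0" for \<epsilon>
  proof -
    have "\<forall>i\<in>{..<n}. \<exists>\<delta>>0. \<forall>u\<in>Q. \<forall>v\<in>Q. dist u v < \<delta> \<longrightarrow> \<bar>\<phi> i u - \<phi> i v\<bar> \<le> \<epsilon>"
    proof
      fix i assume "i \<in> {..<n}"
      then have "uniformly_continuous_on Q (\<phi> i)" using compact_uniformly_continuous cont Q by blast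
      then show "\<exists>\<delta>>0. \<forall>u\<in>Q. \<forall>v\<in>Q. dist u v < \<delta> \<longrightarrow> \<bar>\<phi> i u - \<phi> i v\<bar> \<le> \<epsilon>"
        using that unfolding uniformly_continuous_on_def by (metis dist_real_def less_imp_le)
    qed
    then obtain \<delta> where \<delta>: "\<And>i. i < n \<Longrightarrow> \<delta> i > 0"
      "\<And>i u v. \<lbrakk>i < n; u \<in> Q; v \<in> Q; dist u v < \<delta> i\<rbrakk> \<Longrightarrow> \<bar>\<phi> i u - \<phi> i v\<bar> \<le> \<epsilon>"
      unfolding bchoice_iff by auto
    define \<eta> where "\<eta> = Min (insert 1 (\<delta> ` {..<n}))"
    have \<eta>: "\<eta> > 0" "\<And>i. i < n \<Longrightarrow> \<eta> \<le> \<delta> i" using \<delta> by (auto simp: \<eta>_def)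
    define d where "d = \<eta> / (2 * ((real n + 1) * M))"
    have "(real n + 1) * M > 0" using M by simp
    then have "d > 0" "(real n + 1) * M * d = \<eta> / 2" using \<eta>(1) unfolding d_def by auto
    moreover have "(real n + 1) * d * M = (real n + 1) * M * d" by simp
    ultimately have d: "d > 0" "(real n + 1) * d * M < \<eta>" using \<eta>(1) by linarith+
    show ?thesis
    proof (intro exI[of _ d] conjI d(1) allI impI)
      fix t s i assume ts: "\<forall>j<n. t j \<in> {0..1} \<and> s j \<in> {0..1} \<and> \<bar>t j - s j\<bar> \<le> d" and i: "i < n"
      have "x t - x s = (\<Sum>i<n. (t i / N t - s i / N s) *\<^sub>R (w i - w0))"
        by (simp add: x_def scaleR_diff_left sum_subtractf)
      then have "norm (x t - x s) \<le> (real n + 1) * d * M" using lin[OF coeff[OF ts]] d(1) by simp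
      then have "dist (x t) (x s) < \<delta> i" using d \<eta>(2)[OF i] by (simp add: dist_norm)
      then show "\<bar>\<phi> i (x t) - \<phi> i (x s)\<bar> \<le> \<epsilon>" using \<delta>(2)[OF i] xQ ts by blast
    qed
  qed
  moreover have "\<phi> i (x t) \<in> {0..1}" if "\<forall>j<n. t j \<in> {0..1}" "i < n" for t i
    using nonneg[OF _ xQ[OF that(1)]] sum1[OF xQ[OF that(1)]] that(2)
      member_le_sum[of i "{..<n}" "\<lambda>i. \<phi> i (x t)"] by auto
  moreover define \<eta> where "\<eta> = e / ((real n + 1) * M)"
  moreover have "\<eta> > 0" using e M by (simp add: \<eta>_def)
  ultimately obtain t where t: "\<forall>j<n. t j \<in> {0..1}" "\<forall>i<n. \<bar>\<phi> i (x t) - t i\<bar> \<le> \<eta>"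
    using cube_approximate_fixpoint[of n "\<lambda>t i. \<phi> i (x t)" \<eta>] by metis
  have xt: "x t \<in> Q" using xQ t by blast
  let ?s = "\<lambda>i. \<phi> i (x t)"
  have s: "\<forall>j<n. t j \<in> {0..1} \<and> ?s j \<in> {0..1} \<and> \<bar>t j - ?s j\<bar> \<le> \<eta>"
    using t nonneg xt sum1[OF xt] member_le_sum[of _ "{..<n}" ?s] by (auto simp: abs_minus_commute)
  \<comment> \<open>This identifies the weighted mean with \<open>x ?s\<close>, so the Lipschitz
    bound applies to it and \<open>x t\<close>.\<close>
  have "N ?s = 1" using sum1[OF xt] by (simp add: N_def)
  have "(\<Sum>i<n. ?s i *\<^sub>R w i) = w0 + (\<Sum>i<n. ?s i *\<^sub>R (w i - w0))"
    using sum1[OF xt] by (simp add: scaleR_diff_right sum_subtractf scaleR_sum_left[symmetric])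
  then have "x t - (\<Sum>i<n. ?s i *\<^sub>R w i) = (\<Sum>i<n. (t i / N t - ?s i / N ?s) *\<^sub>R (w i - w0))"
    using \<open>N ?s = 1\<close> by (simp add: x_def scaleR_diff_left sum_subtractf)
  then have "norm (x t - (\<Sum>i<n. ?s i *\<^sub>R w i)) \<le> (real n + 1) * \<eta> * M"
    using lin[OF coeff[OF s]] \<open>\<eta> > 0\<close> by simp
  also have "\<dots> = e" using M by (simp add: \<eta>_def)
  finally show ?thesis using xt by blast
qed

section \<open>Fixed points of envelopes of discontinuous maps\<close>

text \<open>Averaging \<open>h\<close> over a finite \<open>e\<close>-net with a partition of unity
  gives a continuous map whose value at \<open>x\<close> mixes only values of \<open>h\<close> taken
  within \<open>e\<close> of \<open>x\<close>. As \<open>e\<close> tends to 0, its approximate fixed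
  points accumulate at some \<open>l\<close>, which lies in every closed local hull.\<close>

lemma convex_envelope_fixpoint:
  fixes Q :: "'a::real_normed_vector set"
  assumes Q: "compact Q" "convex Q" "Q \<noteq> {}" and h: "h ` Q \<subseteq> Q"
  shows "\<exists>x\<in>Q. x \<in> cc_envelope Q h x"
proof -
  have approx: "\<exists>x\<in>Q. \<exists>z\<in>convex hull (h ` (cball x e \<inter> Q)). dist x z \<le> e" if e: "e > 0" for e
  proof -
    obtain C where C: "finite C" "C \<subseteq> Q" "Q \<subseteq> (\<Union>c\<in>C. ball c e)"
      using compactE_image[OF Q(1), of Q "\<lambda>c. ball c e"] e by (metis UN_I centre_in_ball open_ball subsetI)
    obtain c n where c: "C = c ` {i::nat. i < n}" using finite_imp_nat_seg_image_inj_on[OF C(1)] by blast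
    define \<psi> where "\<psi> i x = max 0 (e - dist x (c i))" for i x
    define \<phi> where "\<phi> i x = \<psi> i x / (\<Sum>i<n. \<psi> i x)" for i x
    have pos: "(\<Sum>i<n. \<psi> i x) > 0" if "x \<in> Q" for x
    proof -
      obtain i where "i < n" "dist (c i) x < e" using C c \<open>x \<in> Q\<close> by auto
      then show ?thesis by (intro sum_pos2[of _ i]) (auto simp: \<psi>_def dist_commute)
    qed
    obtain x where x: "x \<in> Q" "norm (x - (\<Sum>i<n. \<phi> i x *\<^sub>R h (c i))) \<le> e"
    proof -
      have "\<exists>x\<in>Q. norm (x - (\<Sum>i<n. \<phi> i x *\<^sub>R h (c i))) \<le> e"
      proof (rule convex_approximate_fixpoint)
        show "h (c i) \<in> Q" if "i < n" for i using that C c h by auto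
        show "continuous_on Q (\<phi> i)" for i
          unfolding \<phi>_def \<psi>_def using pos[unfolded \<psi>_def] by (intro continuous_intros) fastforce
        show "\<phi> i x \<ge> 0" if "x \<in> Q" for i x
          using pos[OF that] by (simp add: \<phi>_def \<psi>_def)
        show "(\<Sum>i<n. \<phi> i x) = 1" if "x \<in> Q" for x
          using pos[OF that] by (simp add: \<phi>_def sum_divide_distrib[symmetric])
      qed (use Q e in auto)
      then show ?thesis using that by blast
    qed
    let ?I = "{i. i < n \<and> \<phi> i x \<noteq> 0}"
    have "(\<Sum>i<n. \<phi> i x *\<^sub>R h (c i)) = (\<Sum>i\<in>?I. \<phi> i x *\<^sub>R h (c i))"
      by (rule sum.mono_neutral_right) auto
    also have "\<dots> \<in> convex hull (h ` (cball x e \<inter> Q))"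
    proof (rule convex_sum)
      have "(\<Sum>i\<in>?I. \<phi> i x) = (\<Sum>i<n. \<phi> i x)" by (rule sum.mono_neutral_left) auto
      then show "(\<Sum>i\<in>?I. \<phi> i x) = 1"
        using pos[OF x(1)] by (simp add: \<phi>_def sum_divide_distrib[symmetric])
      show "\<phi> i x \<ge> 0" for i using pos[OF x(1)] by (simp add: \<phi>_def \<psi>_def)
      show "h (c i) \<in> convex hull (h ` (cball x e \<inter> Q))" if "i \<in> ?I" for i
      proof -
        have "dist x (c i) < e" using that by (auto simp: \<phi>_def \<psi>_def max_def split: if_splits)
        moreover have "c i \<in> Q" using that C c by auto
        ultimately show ?thesis by (intro hull_inc) auto
      qed
    qed auto
    finally show ?thesis using x by (auto simp: dist_norm)
  qed
  have "\<exists>x z. x \<in> Q \<and> z \<in> convex hull (h ` (cball x (1 / Suc k) \<inter> Q)) \<and> dist x z \<le> 1 / Suc k" for k :: nat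
    using approx[of "1 / Suc k"] by auto
  then obtain x z where x: "\<And>k. x k \<in> Q" and z: "\<And>k. z k \<in> convex hull (h ` (cball (x k) (1 / Suc k) \<inter> Q))"
    and xz: "\<And>k::nat. dist (x k) (z k) \<le> 1 / Suc k"
    by metis
  obtain l r where l: "l \<in> Q" and r: "strict_mono (r :: nat \<Rightarrow> nat)" and lim: "(x \<circ> r) \<longlonglongrightarrow> l"
    using Q(1) x unfolding compact_def by metis
  have "l \<in> closure (convex hull (h ` (cball l e \<inter> Q)))" if "e > 0" for e
    unfolding closure_approachable
  proof (intro allI impI)
    fix d :: real assume "d > 0"
    \<comment> \<open>Two errors below \<open>\<eta>\<close> get added, both for the inclusion in
      \<open>cball l e\<close> and for the distance \<open>d\<close>.\<close>
    define \<eta> where "\<eta> = min d e / 2"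
    have \<eta>: "\<eta> > 0" using \<open>d > 0\<close> that by (simp add: \<eta>_def)
    have "\<forall>\<^sub>F k in sequentially. 1 / Suc k < \<eta>"
      using \<eta> LIMSEQ_Suc[OF lim_1_over_n] by (auto dest: order_tendstoD simp del: of_nat_Suc)
    moreover have "\<forall>\<^sub>F k in sequentially. dist ((x \<circ> r) k) l < \<eta>" using lim \<eta> by (rule tendstoD)
    ultimately have "\<forall>\<^sub>F k in sequentially. 1 / Suc k < \<eta> \<and> dist (x (r k)) l < \<eta>"
      by eventually_elim simp
    then obtain k where k: "1 / Suc k < \<eta>" "dist (x (r k)) l < \<eta>"
      using eventually_happens'[OF sequentially_bot] by blast
    have "1 / real (Suc (r k)) \<le> 1 / Suc k" using seq_suble[OF r, of k] by (intro divide_left_mono) auto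
    then have rk: "1 / real (Suc (r k)) < \<eta>" using k by simp
    have "cball (x (r k)) (1 / Suc (r k)) \<subseteq> cball l e"
    proof
      fix u assume "u \<in> cball (x (r k)) (1 / Suc (r k))"
      then have "dist (x (r k)) u < \<eta>" using rk by (simp del: of_nat_Suc)
      then have "dist l u < \<eta> + \<eta>" using k(2) dist_triangle3[of l u "x (r k)"] by simp
      then show "u \<in> cball l e" by (simp add: \<eta>_def)
    qed
    then have "z (r k) \<in> convex hull (h ` (cball l e \<inter> Q))"
      using z[of "r k"] hull_mono[of "h ` (cball (x (r k)) (1 / Suc (r k)) \<inter> Q)" "h ` (cball l e \<inter> Q)" convex] by blast
    moreover have "dist (z (r k)) l < d"
      using xz[of "r k"] rk k(2) dist_triangle3[of "z (r k)" l "x (r k)"] by (simp add: \<eta>_def del: of_nat_Suc)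
    ultimately show "\<exists>y\<in>convex hull (h ` (cball l e \<inter> Q)). dist y l < d" by blast
  qed
  then show ?thesis using l by (auto simp: cc_envelope_def)
qed

section \<open>Compact convex hulls and normal cones\<close>

text \<open>Mazur's theorem. The hull of \<open>A\<close> stays within \<open>e/4\<close> of the
  compact hull of a finite net \<open>F\<close>, which has its own finite \<open>e/4\<close>-net
  \<open>G\<close>; the closure costs a third \<open>e/4\<close>. Completeness turns total
  boundedness into compactness.\<close>

lemma compact_closure_convex_hull:
  fixes A :: "'a::banach set"
  assumes "compact (closure A)"
  shows "compact (closure (convex hull A))"
  unfolding compact_eq_totally_bounded
proof (intro conjI allI impI)
  show "complete (closure (convex hull A))" by (simp add: complete_eq_closed)
  fix e :: real assume e: "e > 0"
  obtain F where F: "finite F" "closure A \<subseteq> (\<Union>x\<in>F. ball x (e/4))"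
    using assms e unfolding compact_eq_totally_bounded by (meson divide_pos_pos zero_less_numeral)
  have "compact (convex hull F)" using F by (simp add: finite_imp_compact_convex_hull)
  then obtain G where G: "finite G" "convex hull F \<subseteq> (\<Union>x\<in>G. ball x (e/4))"
    using e unfolding compact_eq_totally_bounded by (meson divide_pos_pos zero_less_numeral)
  have "A \<subseteq> F + ball 0 (e/4)"
  proof
    fix a assume "a \<in> A"
    then have "a \<in> closure A" using closure_subset by blast
    then obtain f where "f \<in> F" "dist f a < e/4" using F by auto
    then show "a \<in> F + ball 0 (e/4)"
      using set_plus_intro[of f F "a - f" "ball 0 (e/4)"] by (simp add: dist_norm norm_minus_commute)
  qed
  then have "convex hull A \<subseteq> convex hull F + ball 0 (e/4)"
    by (metis convex_hull_set_plus hull_mono convex_ball hull_same)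
  show "\<exists>k. finite k \<and> closure (convex hull A) \<subseteq> (\<Union>x\<in>k. ball x e)"
  proof (intro exI conjI subsetI)
    fix x assume "x \<in> closure (convex hull A)"
    then obtain u where u: "u \<in> convex hull A" "dist u x < e/4"
      using e unfolding closure_approachable by (meson divide_pos_pos zero_less_numeral)
    then obtain f b where f: "u = f + b" "f \<in> convex hull F" "norm b < e/4"
      using \<open>convex hull A \<subseteq> convex hull F + ball 0 (e/4)\<close> by (auto simp: set_plus_def)
    then obtain g where g: "g \<in> G" "dist g f < e/4" using G by auto
    have "dist f u < e/4" using f by (simp add: dist_norm)
    then have "dist g x < e" using g u e dist_triangle[of g x f] dist_triangle[of f x u] by linarith
    then show "x \<in> (\<Union>x\<in>G. ball x e)" using g by auto
  qed (rule G)
qed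

lemma normal_coneD:
  assumes "normal_cone K c"
  shows "closed K" "convex K" "0 \<in> K" "c > 0" "\<And>x r. \<lbrakk>x \<in> K; r \<ge> 0\<rbrakk> \<Longrightarrow> r *\<^sub>R x \<in> K"
    "\<And>u v. \<lbrakk>u \<in> K; v - u \<in> K\<rbrakk> \<Longrightarrow> norm u \<le> c * norm v"
    "\<And>u v. \<lbrakk>u \<in> K; v \<in> K\<rbrakk> \<Longrightarrow> u + v \<in> K"
proof -
  show K: "closed K" "convex K" "0 \<in> K" "c > 0" "\<And>x r. \<lbrakk>x \<in> K; r \<ge> 0\<rbrakk> \<Longrightarrow> r *\<^sub>R x \<in> K"
    "\<And>u v. \<lbrakk>u \<in> K; v - u \<in> K\<rbrakk> \<Longrightarrow> norm u \<le> c * norm v"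
    using assms by (auto simp: normal_cone_def is_cone_def cone_le_def)
  fix u v assume "u \<in> K" "v \<in> K"
  then have "(1/2) *\<^sub>R u + (1/2) *\<^sub>R v \<in> K" using convexD[OF K(2)] by simp
  then have "2 *\<^sub>R ((1/2) *\<^sub>R u + (1/2) *\<^sub>R v) \<in> K" by (rule K) simp
  then show "u + v \<in> K" by (simp add: scaleR_add_right)
qed

lemma normal_cone_sum:
  assumes "normal_cone K c" "\<And>i. i \<in> S \<Longrightarrow> f i \<in> K"
  shows "sum f S \<in> K"
  using assms(2) by (induction S rule: infinite_finite_induct) (auto intro: normal_coneD[OF assms(1)])

text \<open>The terms of a convex combination are grouped by a nearby centre from a finite
  \<open>m/4\<close>-net. Some group has weight bounded below, and its terms are too close together
  to cancel. The whole sum dominates this partial sum in the cone order, so normality transfers the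
  lower bound.\<close>

lemma normal_cone_convex_hull_norm_ge:
  assumes K: "normal_cone K c" and A: "A \<subseteq> K" "compact (closure A)" 
    and m: "m > 0" "\<And>v. v \<in> A \<Longrightarrow> norm v \<ge> m"
  shows "\<exists>k>0. \<forall>v\<in>convex hull A. norm v \<ge> k"
proof -
  note KD = normal_coneD[OF K]
  obtain F where F: "finite F" "closure A \<subseteq> (\<Union>x\<in>F. ball x (m/4))"
    using A(2) m(1) unfolding compact_eq_totally_bounded by (meson divide_pos_pos zero_less_numeral)
  then have "\<forall>a\<in>A. \<exists>f\<in>F. dist f a < m/4" using closure_subset by fastforce
  then obtain \<pi> where \<pi>: "\<And>a. a \<in> A \<Longrightarrow> \<pi> a \<in> F \<and> dist (\<pi> a) a < m/4" by metis
  define k where "k = m / (2 * c * (1 + real (card F)))"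
  have k: "k > 0" using m KD(4) by (simp add: k_def)
  have "norm v \<ge> k" if v_hull: "v \<in> convex hull A" for v
  proof -
    obtain S u where S: "finite S" "S \<subseteq> A" "\<And>x. x \<in> S \<Longrightarrow> 0 \<le> u x" "sum u S = 1"
      and v: "v = (\<Sum>x\<in>S. u x *\<^sub>R x)"
      using v_hull unfolding convex_hull_explicit by blast
    define \<mu> where "\<mu> f = (\<Sum>x\<in>{x\<in>S. \<pi> x = f}. u x)" for f
    have \<mu>1: "(\<Sum>f\<in>F. \<mu> f) = 1"
    proof -
      have "\<pi> ` S \<subseteq> F" using \<pi> S(2) by blast
      then show ?thesis unfolding \<mu>_def using sum.group[OF S(1) F(1), of \<pi> u] S(4) by simp
    qed
    \<comment> \<open>Pigeonhole; the extra 1 in the denominator makes the total fall strictly short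
      of 1 in the contrary case.\<close>
    have "\<exists>f\<in>F. \<mu> f \<ge> 1 / (1 + real (card F))"
    proof (rule ccontr)
      assume "\<not> ?thesis"
      then have "(\<Sum>f\<in>F. \<mu> f) \<le> card F * (1 / (1 + real (card F)))"
        by (intro sum_bounded_above) auto
      then show False using \<mu>1 by (simp add: field_simps)
    qed
    then obtain f where f: "f \<in> F" "\<mu> f \<ge> 1 / (1 + real (card F))" by blast
    let ?S = "{x\<in>S. \<pi> x = f}"
    define w where "w = (\<Sum>x\<in>?S. u x *\<^sub>R x)"
    have "\<mu> f > 0" using f(2) by (smt (verit) divide_pos_pos of_nat_0_le_iff)
    then have "?S \<noteq> {}" unfolding \<mu>_def by force
    then obtain a where a: "a \<in> S" "\<pi> a = f" by blast
    \<comment> \<open>Replacing the terms of the group by \<open>f\<close> costs \<open>m/4\<close>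
      per unit of weight, which leaves \<open>m/2\<close>.\<close>
    have fm: "norm f \<ge> 3 * m / 4"
      using \<pi>[of a] m(2)[of a] a S(2) norm_triangle_ineq2[of a f] by (auto simp: dist_norm norm_minus_commute)
    have "w - \<mu> f *\<^sub>R f = (\<Sum>x\<in>?S. u x *\<^sub>R (x - f))"
      by (simp add: w_def \<mu>_def scaleR_diff_right sum_subtractf scaleR_sum_left)
    also have "norm \<dots> \<le> (\<Sum>x\<in>?S. u x * (m/4))"
    proof (rule sum_norm_le)
      fix x assume "x \<in> ?S"
      then have "norm (x - f) \<le> m/4" "u x \<ge> 0" using \<pi>[of x] S by (auto simp: dist_norm norm_minus_commute)
      then show "norm (u x *\<^sub>R (x - f)) \<le> u x * (m/4)"
        using mult_left_mono[of "norm (x - f)" "m/4" "u x"] by simp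
    qed
    also have "\<dots> = \<mu> f * (m/4)" by (simp add: \<mu>_def sum_distrib_right)
    finally have "norm (w - \<mu> f *\<^sub>R f) \<le> \<mu> f * (m/4)" .
    moreover have "norm (\<mu> f *\<^sub>R f) \<ge> \<mu> f * (3 * m / 4)"
      using fm \<open>\<mu> f > 0\<close> by (simp add: mult_left_mono)
    moreover have "norm (\<mu> f *\<^sub>R f) - norm w \<le> norm (w - \<mu> f *\<^sub>R f)"
      by (metis norm_minus_commute norm_triangle_ineq2)
    ultimately have "norm w \<ge> \<mu> f * (3 * m / 4) - \<mu> f * (m/4)" by linarith
    then have "norm w \<ge> \<mu> f * (m/2)" by (simp add: algebra_simps)
    moreover have "\<mu> f * (m/2) \<ge> 1 / (1 + real (card F)) * (m/2)"
      using f m by (intro mult_right_mono) auto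
    moreover have "norm w \<le> c * norm v"
    proof (rule KD(6))
      show "w \<in> K" unfolding w_def using S A by (intro normal_cone_sum[OF K] KD(5)) auto
      have "v - w = (\<Sum>x\<in>S - ?S. u x *\<^sub>R x)"
        unfolding v w_def using S(1) by (subst sum_diff) auto
      also have "\<dots> \<in> K" using S A by (intro normal_cone_sum[OF K] KD(5)) auto
      finally show "v - w \<in> K" .
    qed
    ultimately have "1 / (1 + real (card F)) * (m/2) \<le> c * norm v" by linarith
    then have "1 / (1 + real (card F)) * (m/2) / c \<le> norm v"
      unfolding pos_divide_le_eq[OF KD(4)] by (simp only: mult.commute)
    moreover have "k = 1 / (1 + real (card F)) * (m/2) / c" by (simp add: k_def)
    ultimately show ?thesis by simp
  qed
  then show ?thesis using k by blast
qed

section \<open>Closure and boundary relative to the shifted cone\<close>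

lemma DK_closure_eq: "closed K \<Longrightarrow> DK_closure D K y = closure (DK D K y)"
proof -
  assume "closed K"
  then have "closed (shifted_cone y K)" by (simp add: shifted_cone_def closed_translation)
  then have "closure (DK D K y) \<subseteq> shifted_cone y K" by (intro closure_minimal) (auto simp: DK_def)
  moreover have "shifted_cone y K \<inter> DK D K y = DK D K y" by (auto simp: DK_def)
  ultimately show ?thesis by (auto simp: DK_closure_def closure_of_subtopology)
qed

lemma DK_boundary_eq:
  assumes "closed K" "open D"
  shows "DK_boundary D K y = closure (DK D K y) - DK D K y"
proof -
  have "openin (top_of_set (shifted_cone y K)) (DK D K y)"
    unfolding DK_def by (metis Int_commute assms(2) open_translation openin_open_Int)
  then show ?thesis
    using DK_closure_eq[OF assms(1), of D y]
    by (simp add: DK_boundary_def DK_closure_def frontier_of_def interior_of_openin)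
qed

text \<open>Links the relative boundary to the supremum over \<open>frontier D\<close>. Limits stay
  in the closed shifted cone, so a limit point outside \<open>DK D K y\<close> can only have left
  the translate of \<open>D\<close>.\<close>

lemma DK_boundary_subset_frontier:
  assumes "closed K" "open D" "x \<in> DK_boundary D K y"
  shows "x - y \<in> frontier D"
proof -
  have x: "x \<in> closure (DK D K y)" "x \<notin> DK D K y" using assms DK_boundary_eq by blast+
  have "closed (shifted_cone y K)" using assms by (simp add: shifted_cone_def closed_translation)
  then have "closure (DK D K y) \<subseteq> shifted_cone y K" by (intro closure_minimal) (auto simp: DK_def)
  then have "x \<in> shifted_cone y K" using x by blast
  then have "x - y \<notin> D" using x(2) by (force simp: DK_def)
  moreover have "closure (DK D K y) \<subseteq> (+) y ` closure D"
    unfolding closure_translation[symmetric] by (intro closure_mono) (auto simp: DK_def)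
  then have "x - y \<in> closure D" using x(1) by auto
  ultimately show ?thesis using assms(2) by (simp add: frontier_def interior_open)
qed

section \<open>Limits, locality and affine images of envelopes\<close>

text \<open>Relative compactness gives a convergent subsequence; local hulls shrink with the radius,
  so its tail stays in each of the closed hulls being intersected.\<close>

lemma cc_envelope_limit:
  fixes S :: "'a::banach \<Rightarrow> 'a"
  assumes comp: "compact (closure (S ` U))"
    and v: "\<And>k. v k \<in> convex hull (S ` (cball x (1 / real (Suc k)) \<inter> U))"
  obtains l r where "l \<in> cc_envelope U S x" "strict_mono (r :: nat \<Rightarrow> nat)" "(v \<circ> r) \<longlonglongrightarrow> l"
proof -
  have "v k \<in> closure (convex hull (S ` U))" for k
    using v[of k] hull_mono[of "S ` (cball x (1 / real (Suc k)) \<inter> U)" "S ` U" convex] closure_subset by blast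
  then obtain l r where r: "strict_mono r" and lim: "(v \<circ> r) \<longlonglongrightarrow> l"
    using compact_closure_convex_hull[OF comp] unfolding compact_def by metis
  have "l \<in> closure (convex hull (S ` (cball x e \<inter> U)))" if "e > 0" for e
  proof (rule Lim_in_closed_set[OF closed_closure _ sequentially_bot lim])
    have "\<forall>\<^sub>F k in sequentially. 1 / real (Suc k) < e"
      using that LIMSEQ_Suc[OF lim_1_over_n] by (auto dest: order_tendstoD simp del: of_nat_Suc)
    then show "\<forall>\<^sub>F k in sequentially. (v \<circ> r) k \<in> closure (convex hull (S ` (cball x e \<inter> U)))"
    proof eventually_elim
      case (elim k)
      have "1 / real (Suc (r k)) \<le> 1 / Suc k" using seq_suble[OF r, of k] by (intro divide_left_mono) auto
      then have "cball x (1 / real (Suc (r k))) \<subseteq> cball x e" using elim by (intro subset_cball) simp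
      then have "convex hull (S ` (cball x (1 / real (Suc (r k))) \<inter> U)) \<subseteq> convex hull (S ` (cball x e \<inter> U))"
        by (intro hull_mono image_mono) blast
      then show ?case using v[of "r k"] closure_subset by fastforce
    qed
  qed
  then show ?thesis using that r lim by (auto simp: cc_envelope_def)
qed

text \<open>Smaller balls have smaller hulls, so only radii up to \<open>d\<close> matter in the
  intersection.\<close>

lemma cc_envelope_cong_near:
  assumes "d > 0" "\<And>z. z \<in> cball x d \<inter> U \<Longrightarrow> S z = S' z"
  shows "cc_envelope U S x \<subseteq> cc_envelope U S' x"
proof
  fix v assume v: "v \<in> cc_envelope U S x"
  have "v \<in> closure (convex hull (S' ` (cball x e \<inter> U)))" if "e > 0" for e
  proof -
    have "v \<in> closure (convex hull (S ` (cball x (min d e) \<inter> U)))"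
      using v assms(1) that by (auto simp: cc_envelope_def)
    moreover have "S ` (cball x (min d e) \<inter> U) \<subseteq> S' ` (cball x e \<inter> U)" using assms(2) by force
    ultimately show ?thesis by (meson closure_mono hull_mono subsetD)
  qed
  then show "v \<in> cc_envelope U S' x" by (auto simp: cc_envelope_def)
qed

text \<open>Affine maps commute with convex hulls and, being continuous here, map closures into
  closures.\<close>

lemma cc_envelope_affinity:
  assumes "v \<in> cc_envelope U S x"
  shows "y + r *\<^sub>R v \<in> cc_envelope U (\<lambda>z. y + r *\<^sub>R S z) x"
proof -
  have "y + r *\<^sub>R v \<in> closure (convex hull ((\<lambda>z. y + r *\<^sub>R S z) ` (cball x e \<inter> U)))" if "e > 0" for e
  proof -
    let ?H = "convex hull (S ` (cball x e \<inter> U))"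
    have "convex hull ((\<lambda>z. y + r *\<^sub>R S z) ` (cball x e \<inter> U)) = (\<lambda>v. y + r *\<^sub>R v) ` ?H"
      by (simp add: convex_hull_affinity[symmetric] image_image)
    moreover have "(\<lambda>v. y + r *\<^sub>R v) ` closure ?H \<subseteq> closure ((\<lambda>v. y + r *\<^sub>R v) ` ?H)"
      by (intro image_closure_subset continuous_intros closed_closure closure_subset)
    moreover have "v \<in> closure ?H" using assms that by (auto simp: cc_envelope_def)
    ultimately show ?thesis by auto
  qed
  then show ?thesis by (auto simp: cc_envelope_def)
qed

section \<open>A positive eigenvalue on the relative boundary\<close>

theorem theorem2p13:
  fixes K D :: "'a::banach set" and y :: 'a and c lbar :: real and T :: "'a \<Rightarrow> 'a"
  assumes normal: "normal_cone K c"
    and nontriv: "K \<noteq> {0}"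
    and D_open: "open D" and D_bdd: "bounded D" and D0: "0 \<in> D"
    and T_maps: "T ` DK_closure D K y \<subseteq> K"
    and T_rc: "compact (closure (T ` DK_closure D K y))"
    and inf_pos: "Inf {norm v | v x. x \<in> DK_boundary D K y \<and> v \<in> cc_envelope (DK_closure D K y) T x} > 0"
    and lbar_gt: "lbar > c * Sup (norm ` frontier D) /
                   Inf {norm v | v x. x \<in> DK_boundary D K y \<and> v \<in> cc_envelope (DK_closure D K y) T x}"
    and fix_cond: "\<forall>lam\<in>{0<..lbar}. \<forall>x\<in>DK_closure D K y.
                     {x} \<inter> cc_envelope (DK_closure D K y) (\<lambda>z. y + lam *\<^sub>R T z) x \<subseteq> {y + lam *\<^sub>R T x}"
  shows "\<exists>x\<in>DK_boundary D K y. \<exists>lam\<in>{0<..<lbar}. x = y + lam *\<^sub>R T x"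
proof -
  note KD = normal_coneD[OF normal]
  define Cl W bd where "Cl = DK_closure D K y" and "W = DK D K y" and "bd = DK_boundary D K y"
  define m where "m = Inf {norm v | v x. x \<in> bd \<and> v \<in> cc_envelope Cl T x}"
  have m: "m > 0" using inf_pos by (simp add: m_def bd_def Cl_def)
  have m_le: "m \<le> norm v" if "x \<in> bd" "v \<in> cc_envelope Cl T x" for x v
    unfolding m_def using that by (intro cInf_lower bdd_belowI[of _ 0]) auto
  have Cl: "Cl = closure W" and bd: "bd = Cl - W"
    using DK_closure_eq[OF KD(1)] DK_boundary_eq[OF KD(1) D_open] by (simp_all add: Cl_def W_def bd_def)
  have W_iff: "x \<in> W \<longleftrightarrow> x - y \<in> D \<and> x - y \<in> K" for x
    by (force simp: W_def DK_def shifted_cone_def)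
  have yW: "y \<in> W" using D0 KD(3) by (simp add: W_iff)
  have "W \<subseteq> (+) y ` D" by (auto simp: W_def DK_def)
  then have "bounded Cl" unfolding Cl using D_bdd by (meson bounded_closure bounded_subset bounded_translation)
  then obtain B where B: "\<And>x. x \<in> Cl \<Longrightarrow> norm (x - y) \<le> B"
    by (metis bounded_any_center dist_norm dist_commute)

  \<comment> \<open>Nontriviality of \<open>K\<close> supplies the replacement value:
    \<open>k0\<close> rescaled to norm \<open>m\<close>.\<close>
  obtain k0 where k0: "k0 \<in> K" "k0 \<noteq> 0" using nontriv KD(3) by blast
  define a where "a = (m / norm k0) *\<^sub>R k0"
  have a: "a \<in> K" "norm a = m" using k0 m KD(5) by (simp_all add: a_def)

  define T' where "T' z = (if z \<in> Cl \<and> norm (T z) \<ge> m/2 then T z else a)" for z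
  have T'_sub: "range T' \<subseteq> insert a (T ` Cl)" by (auto simp: T'_def)
  then have T'_K: "range T' \<subseteq> K" using a T_maps by (auto simp: Cl_def)
  have "closure (range T') \<subseteq> insert a (closure (T ` Cl))"
    using closure_mono[OF T'_sub] by (simp add: closure_insert)
  moreover have "compact (insert a (closure (T ` Cl)))" using T_rc by (auto simp: Cl_def)
  ultimately have T'_comp: "compact (closure (range T'))"
    using compact_Int_closed[OF _ closed_closure] by (metis Int_absorb1)
  have "m/2 \<le> norm v" if "v \<in> range T'" for v using that a m by (auto simp: T'_def)
  then obtain k where k: "k > 0" "\<And>v. v \<in> convex hull range T' \<Longrightarrow> norm v \<ge> k"
    using normal_cone_convex_hull_norm_ge[OF normal T'_K T'_comp, of "m/2"] m by auto
  have "B \<ge> 0" using B[of y] yW Cl closure_subset by fastforce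
  \<comment> \<open>Chosen so that \<open>L * k = B + 1\<close>, beyond the radius \<open>B\<close>
    of \<open>Cl\<close> about \<open>y\<close>.\<close>
  define L where "L = (B + 1) / k"
  have L: "L > 0" "L * k > B" using k \<open>B \<ge> 0\<close> by (auto simp: L_def)

  \<comment> \<open>Inserting 0 puts \<open>y\<close>, the value of \<open>h\<close> off
    \<open>Cl\<close>, into \<open>Q\<close>.\<close>
  define H where "H = closure (convex hull (insert 0 (range T')))"
  define Q where "Q = (\<lambda>v. y + L *\<^sub>R v) ` H"
  define h where "h x = (if x \<in> Cl then y + L *\<^sub>R T' x else y)" for x
  have "compact H" unfolding H_def using T'_comp
    by (intro compact_closure_convex_hull) (simp add: closure_insert)
  then have "compact Q" unfolding Q_def by (intro compact_continuous_image continuous_intros)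
  moreover have "convex Q" unfolding Q_def H_def by (intro convex_affinity convex_closure convex_convex_hull)
  moreover have H_mem: "insert 0 (range T') \<subseteq> H" unfolding H_def by (meson closure_subset hull_subset order_trans)
  then have "y + L *\<^sub>R 0 \<in> Q" "\<And>x. y + L *\<^sub>R T' x \<in> Q" unfolding Q_def by (blast intro: imageI)+
  then have "h ` Q \<subseteq> Q" "Q \<noteq> {}" by (auto simp: h_def)
  ultimately obtain x where xQ: "x \<in> Q" and env_h: "x \<in> cc_envelope Q h x"
    using convex_envelope_fixpoint by metis
  have x_h: "x \<in> closure (convex hull (h ` (cball x e \<inter> Q)))" if "e > 0" for e
    using env_h that by (auto simp: cc_envelope_def)
  \<comment> \<open>Thus \<open>Q\<close> lies in the shifted cone, relative to which
    \<open>W\<close> is open: points of \<open>Q\<close> near a point of \<open>W\<close> are in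
    \<open>W\<close>.\<close>
  have "H \<subseteq> K" unfolding H_def using T'_K KD by (intro closure_minimal hull_minimal) auto
  then have Q_K: "z - y \<in> K" if "z \<in> Q" for z using that KD(5) L by (auto simp: Q_def)

  have xCl: "x \<in> Cl"
  proof (rule ccontr)
    assume "x \<notin> Cl"
    then obtain e where e: "e > 0" "cball x e \<subseteq> - Cl"
      using open_contains_cball[of "- Cl"] by (auto simp: Cl)
    then have "h ` (cball x e \<inter> Q) \<subseteq> {y}" by (auto simp: h_def)
    then have "closure (convex hull (h ` (cball x e \<inter> Q))) \<subseteq> {y}"
      by (intro closure_minimal hull_minimal) auto
    then have "x = y" using x_h[OF e(1)] by blast
    then show False using \<open>x \<notin> Cl\<close> yW closure_subset Cl by blast
  qed
  \<comment> \<open>Otherwise all values of \<open>h\<close> near \<open>x\<close> come from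
    \<open>T'\<close>, so \<open>x\<close> inherits the closed condition of distance at least
    \<open>L * k\<close> from \<open>y\<close>.\<close>
  have "x \<notin> W"
  proof
    assume "x \<in> W"
    then have "x \<in> (+) y ` D" using \<open>W \<subseteq> (+) y ` D\<close> by blast
    then obtain e where e: "e > 0" "cball x e \<subseteq> (+) y ` D"
      using open_contains_cball D_open open_translation by metis
    have "cball x e \<inter> Q \<subseteq> W" using e Q_K by (force simp: W_iff)
    then have "cball x e \<inter> Q \<subseteq> Cl" using closure_subset Cl by blast
    then have "h ` (cball x e \<inter> Q) \<subseteq> (\<lambda>v. y + L *\<^sub>R v) ` range T'" by (auto simp: h_def)
    then have "convex hull (h ` (cball x e \<inter> Q)) \<subseteq> (\<lambda>v. y + L *\<^sub>R v) ` (convex hull range T')"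
      by (metis convex_hull_affinity hull_mono)
    also have "\<dots> \<subseteq> {z. L * k \<le> norm (z - y)}" using k L by (auto intro!: mult_left_mono)
    finally have "closure (convex hull (h ` (cball x e \<inter> Q))) \<subseteq> {z. L * k \<le> norm (z - y)}"
      by (intro closure_minimal closed_Collect_le continuous_intros)
    then show False using x_h[OF e(1)] L B[OF xCl] by fastforce
  qed
  then have x_bd: "x \<in> bd" using xCl bd by blast

  \<comment> \<open>Otherwise small values of \<open>T\<close> would accumulate at a member of the
    envelope at \<open>x\<close> with norm at most \<open>m/2\<close>, below the infimum
    \<open>m\<close>.\<close>
  have "\<exists>d>0. \<forall>z \<in> cball x d \<inter> Cl. norm (T z) \<ge> m/2"
  proof (rule ccontr)
    assume "\<not> ?thesis"
    then have "\<exists>z \<in> cball x d \<inter> Cl. norm (T z) < m/2" if "d > 0" for d using that by (meson not_le)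
    then have "\<exists>z. z \<in> cball x (1 / real (Suc k)) \<inter> Cl \<and> norm (T z) < m/2" for k
      by (metis of_nat_0_less_iff zero_less_Suc zero_less_divide_1_iff)
    then obtain z where z: "\<And>k. z k \<in> cball x (1 / real (Suc k)) \<inter> Cl" "\<And>k. norm (T (z k)) < m/2"
      by metis
    have "T (z k) \<in> convex hull (T ` (cball x (1 / real (Suc k)) \<inter> Cl))" for k
      using z(1) by (intro hull_inc imageI)
    then obtain l r where l: "l \<in> cc_envelope Cl T x" "((\<lambda>k. T (z k)) \<circ> r) \<longlonglongrightarrow> l"
      using cc_envelope_limit[of T Cl "\<lambda>k. T (z k)" x] T_rc unfolding Cl_def by metis
    have "norm l \<le> m/2"
      by (rule Lim_bounded[OF tendsto_norm[OF l(2)], of 0]) (use z(2) in \<open>auto intro: less_imp_le\<close>)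
    then show False using m_le[OF x_bd l(1)] m by simp
  qed
  then obtain d where d: "d > 0" "\<And>z. z \<in> cball x d \<inter> Cl \<Longrightarrow> norm (T z) \<ge> m/2" by blast

  \<comment> \<open>Near \<open>x\<close>, \<open>h\<close> takes the value \<open>y\<close> off
    \<open>Cl\<close> and values \<open>y + L T'\<close> on it; \<open>s\<close> is the total weight
    of the latter in a convex combination.\<close>
  have "\<exists>v s. v \<in> convex hull (T' ` (cball x (1 / real (Suc k)) \<inter> Cl)) \<and> s \<in> {0..1} \<and>
      dist (y + (s * L) *\<^sub>R v) x < 1 / real (Suc k)" for k
  proof -
    let ?C = "cball x (1 / real (Suc k)) \<inter> Cl"
    have "x \<in> ?C" using xCl by simp
    have "h ` (cball x (1 / real (Suc k)) \<inter> Q) \<subseteq> insert y ((\<lambda>v. y + L *\<^sub>R v) ` T' ` ?C)"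
      by (auto simp: h_def)
    then have "x \<in> closure (convex hull (insert y ((\<lambda>v. y + L *\<^sub>R v) ` T' ` ?C)))"
      using x_h[of "1 / real (Suc k)"] by (metis closure_mono hull_mono of_nat_0_less_iff subsetD zero_less_Suc zero_less_divide_1_iff)
    then obtain p where p: "p \<in> convex hull (insert y ((\<lambda>v. y + L *\<^sub>R v) ` T' ` ?C))" "dist p x < 1 / real (Suc k)"
      by (metis closure_approachable of_nat_0_less_iff zero_less_Suc zero_less_divide_1_iff)
    have ne: "(\<lambda>v. y + L *\<^sub>R v) ` T' ` ?C \<noteq> {}" using \<open>x \<in> ?C\<close> by blast
    obtain u s v where s: "u \<ge> 0" "s \<ge> 0" "u + s = 1" "v \<in> convex hull (T' ` ?C)"
      "p = u *\<^sub>R y + s *\<^sub>R (y + L *\<^sub>R v)"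
      using p(1) unfolding convex_hull_insert[OF ne] convex_hull_affinity by blast
    have "p = (u + s) *\<^sub>R y + (s * L) *\<^sub>R v" by (simp add: s(5) scaleR_add_left scaleR_add_right)
    then show ?thesis using s p(2) by (intro exI[of _ v] exI[of _ s]) auto
  qed
  then obtain v s where v: "\<And>k. v k \<in> convex hull (T' ` (cball x (1 / real (Suc k)) \<inter> Cl))"
    and s: "\<And>k. s k \<in> {0..1}" and dist_x: "\<And>k. dist (y + (s k * L) *\<^sub>R v k) x < 1 / real (Suc k)"
    by metis
  have "compact (closure (T' ` Cl))"
    using compact_Int_closed[OF T'_comp closed_closure] by (metis Int_absorb1 closure_mono image_mono subset_UNIV)
  then obtain l r where l: "l \<in> cc_envelope Cl T' x" and r: "strict_mono r" "(v \<circ> r) \<longlonglongrightarrow> l"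
    using cc_envelope_limit v by blast
  \<comment> \<open>A second extraction makes the weights converge as well, so both factors have
    limits along \<open>?q\<close>.\<close>
  obtain t r' where t: "t \<in> {0..1}" and r': "strict_mono r'" "((s \<circ> r) \<circ> r') \<longlonglongrightarrow> t"
    using compact_Icc[of "0::real" 1] s unfolding compact_def by (metis comp_apply)
  let ?q = "r \<circ> r'"
  have "(\<lambda>k. y + (s (?q k) * L) *\<^sub>R v (?q k)) \<longlonglongrightarrow> y + (t * L) *\<^sub>R l"
    using r'(2) LIMSEQ_subseq_LIMSEQ[OF r(2) r'(1)] by (intro tendsto_intros) (auto simp: comp_def)
  moreover have "(\<lambda>k. y + (s k * L) *\<^sub>R v k) \<longlonglongrightarrow> x"
    unfolding tendsto_dist_iff[of _ x]
    by (rule tendsto_sandwich[OF _ _ tendsto_const LIMSEQ_Suc[OF lim_1_over_n]])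
      (use dist_x in \<open>auto intro!: always_eventually less_imp_le simp del: of_nat_Suc\<close>)
  then have "(\<lambda>k. y + (s (?q k) * L) *\<^sub>R v (?q k)) \<longlonglongrightarrow> x"
    using LIMSEQ_subseq_LIMSEQ[OF _ strict_mono_o[OF r(1) r'(1)]] by (force simp: comp_def)
  ultimately have x_eq: "x = y + (t * L) *\<^sub>R l" using LIMSEQ_unique by blast
  have l_T: "l \<in> cc_envelope Cl T x"
    using cc_envelope_cong_near[of d x Cl T' T] d l by (auto simp: T'_def)

  define lam where "lam = t * L"
  have "x \<noteq> y" using \<open>x \<notin> W\<close> yW by blast
  then have "lam > 0" using x_eq t L by (cases "t = 0") (auto simp: lam_def)
  define R where "R = Sup (norm ` frontier D)"
  have "bdd_above (norm ` frontier D)"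
    unfolding bdd_above_norm frontier_def using D_bdd by (meson Diff_subset bounded_closure bounded_subset)
  then have "norm (x - y) \<le> R"
    unfolding R_def using DK_boundary_subset_frontier[OF KD(1) D_open] x_bd
    by (intro cSup_upper) (auto simp: bd_def)
  moreover have "norm (x - y) = lam * norm l" using x_eq \<open>lam > 0\<close> by (simp add: lam_def)
  moreover have "lam * m \<le> lam * norm l" using m_le[OF x_bd l_T] \<open>lam > 0\<close> by simp
  ultimately have "lam * m \<le> R" "R \<ge> 0" using norm_ge_zero[of "x - y"] by linarith+
  \<comment> \<open>\<open>a\<close> precedes itself in the cone order and has positive
    norm.\<close>
  moreover have "c \<ge> 1" using KD(6)[of a a] KD(3) a m by simp
  ultimately have "lam * m \<le> c * R" using mult_right_mono[of 1 c R] by simp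
  then have "lam \<le> c * R / m" using m by (simp add: pos_le_divide_eq)
  also have "\<dots> < lbar" using lbar_gt by (simp add: R_def m_def bd_def Cl_def)
  finally have "lam < lbar" .
  \<comment> \<open>At this \<open>lam\<close> the hypothesis on envelopes turns membership into the
    equation sought.\<close>
  moreover have "x \<in> cc_envelope Cl (\<lambda>z. y + lam *\<^sub>R T z) x"
    using cc_envelope_affinity[OF l_T, of y lam] x_eq by (simp add: lam_def)
  ultimately have "x = y + lam *\<^sub>R T x"
    using fix_cond xCl \<open>lam > 0\<close> unfolding Cl_def by fastforce
  moreover have "lam \<in> {0<..<lbar}" using \<open>lam > 0\<close> \<open>lam < lbar\<close> by simp
  ultimately show ?thesis using x_bd unfolding bd_def by blast
qed

end
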